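(* Let $p$ be a prime, $r\ge1$, $G=\mathbb{Z}_{p^r}$, and let $H$ be a finite abelian group of $p$-rank $t\ge 1$. Let $k\ge t+2$ be an integer and $f:G\to H$ any function. If $f$ passes $\mathsf{Test\_ker}_k(G,H)$ with probability $\delta_k$, then \[\Bigl(\frac{(p-1)^2}{p^2}\,\delta_k\Bigr)^{\frac{1}{k-t-1}} \le \max_{\varphi\in\mathrm{Hom}(G,H)}\mathrm{agr}(f,\varphi) \le \Bigl(\frac{p^2}{p^2-1}\,\delta_k\Bigr)^{\frac1k}.\]
   Context: For finite groups $G,H$ with $H$ abelian, $\mathrm{Hom}(G,H)$ (the group homomorphisms $G\to H$) is an abelian group under pointwise multiplication. $\mathrm{agr}(f,\varphi)=\Pr_{x\sim G}[f(x)=\varphi(x)]$, $x$ uniform. For $\vec x=(x_1,\dots,x_k)\in G^k$ let $\Gamma_{\vec x}:\mathrm{Hom}(G,H)\to H^k$, $\Gamma_{\vec x}(\varphi)=(\varphi(x_1),\dots,\varphi(x_k))$ (a group homomorphism), let $\mathsf{H}_{\vec x}$ be its image, and $\mathcal{G}_k=\{\vec x\in G^k:\mathsf{H}_{\vec x}\ne H^k\}$. The test $\mathsf{Test\_ker}_k(G,H)$, given oracle access to $f:G\to H$: sample $\vec x\in\mathcal{G}_k$ with probability proportional to $|\ker\Gamma_{\vec x}|$; accept iff $(f(x_1),\dots,f(x_k))\in\mathsf{H}_{\vec x}$. The $p$-rank of a finite abelian group is the number of cyclic summands of $p$-power order in its decomposition into cyclic groups of prime-power order. *)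

theory Defs
  imports
    "HOL-Algebra.Elementary_Groups"
    "HOL-Algebra.Product_Groups"
    "HOL-Number_Theory.Prime_Powers"
    "HOL-Probability.Probability_Mass_Function"
begin

(* Homomorphisms are taken extensional outside carrier G, so that each of them is represented by
   exactly one HOL function and cardinalities of sets of homomorphisms are the right ones. *)
definition hom_group ::
  "('a, 'm) monoid_scheme \<Rightarrow> ('b, 'n) monoid_scheme \<Rightarrow> ('a \<Rightarrow> 'b) monoid" where
  "hom_group G H =
    \<lparr>carrier = hom G H \<inter> extensional (carrier G),
     monoid.mult = (\<lambda>\<phi> \<psi>. \<lambda>x\<in>carrier G. \<phi> x \<otimes>\<^bsub>H\<^esub> \<psi> x),
     one = (\<lambda>x\<in>carrier G. \<one>\<^bsub>H\<^esub>)\<rparr>"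

definition power_group :: "('a, 'm) monoid_scheme \<Rightarrow> nat \<Rightarrow> (nat \<Rightarrow> 'a) monoid" where
  "power_group G k = product_group {..<k} (\<lambda>_. G)"

definition agr :: "('a, 'm) monoid_scheme \<Rightarrow> ('a \<Rightarrow> 'b) \<Rightarrow> ('a \<Rightarrow> 'b) \<Rightarrow> real" where
  "agr G f \<phi> = measure_pmf.prob (pmf_of_set (carrier G)) {x. f x = \<phi> x}"

(* Coordinatewise evaluation at a k-tuple; k-tuples are extensional functions on {..<k}. *)
definition eval_tuple :: "nat \<Rightarrow> (nat \<Rightarrow> 'a) \<Rightarrow> ('a \<Rightarrow> 'b) \<Rightarrow> (nat \<Rightarrow> 'b)" where
  "eval_tuple k x \<phi> = (\<lambda>i\<in>{..<k}. \<phi> (x i))"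

definition eval_image ::
  "('a, 'm) monoid_scheme \<Rightarrow> ('b, 'n) monoid_scheme \<Rightarrow> nat \<Rightarrow> (nat \<Rightarrow> 'a) \<Rightarrow> (nat \<Rightarrow> 'b) set" where
  "eval_image G H k x = eval_tuple k x ` carrier (hom_group G H)"

definition eval_kernel ::
  "('a, 'm) monoid_scheme \<Rightarrow> ('b, 'n) monoid_scheme \<Rightarrow> nat \<Rightarrow> (nat \<Rightarrow> 'a) \<Rightarrow> ('a \<Rightarrow> 'b) set" where
  "eval_kernel G H k x = kernel (hom_group G H) (power_group H k) (eval_tuple k x)"

definition test_tuples ::
  "('a, 'm) monoid_scheme \<Rightarrow> ('b, 'n) monoid_scheme \<Rightarrow> nat \<Rightarrow> (nat \<Rightarrow> 'a) set" where
  "test_tuples G H k =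
    {x \<in> carrier (power_group G k). eval_image G H k x \<noteq> carrier (power_group H k)}"

(* embed_pmf is meaningful only if the weights sum to 1; see pmf_test_ker_sample below. *)
definition test_ker_sample ::
  "('a, 'm) monoid_scheme \<Rightarrow> ('b, 'n) monoid_scheme \<Rightarrow> nat \<Rightarrow> (nat \<Rightarrow> 'a) pmf" where
  "test_ker_sample G H k =
    embed_pmf (\<lambda>x. if x \<in> test_tuples G H k
      then real (card (eval_kernel G H k x)) /
           (\<Sum>y\<in>test_tuples G H k. real (card (eval_kernel G H k y)))
      else 0)"

definition test_ker_prob ::
  "('a, 'm) monoid_scheme \<Rightarrow> ('b, 'n) monoid_scheme \<Rightarrow> nat \<Rightarrow> ('a \<Rightarrow> 'b) \<Rightarrow> real" where
  "test_ker_prob G H k f =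
    measure_pmf.prob (test_ker_sample G H k) {x. eval_tuple k x f \<in> eval_image G H k x}"

(* Stated as a relation; the structure theorem for finite abelian groups says that
   for each finite abelian H there is exactly one such t. *)
definition has_p_rank :: "nat \<Rightarrow> ('a, 'm) monoid_scheme \<Rightarrow> nat \<Rightarrow> bool" where
  "has_p_rank p H t \<longleftrightarrow>
    (\<exists>(n::nat) (q::nat \<Rightarrow> nat).
       (\<forall>i<n. primepow (q i)) \<and>
       H \<cong> product_group {..<n} (\<lambda>i. integer_mod_group (q i)) \<and>
       t = card {i. i < n \<and> (\<exists>e>0. q i = p ^ e)})"

lemma finite_hom_group:
  assumes "finite (carrier G)" "finite (carrier H)"
  shows "finite (carrier (hom_group G H))"
proof (rule finite_subset)
  show "carrier (hom_group G H) \<subseteq> carrier G \<rightarrow>\<^sub>E carrier H"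
    by (auto simp: hom_group_def hom_def PiE_def)
  show "finite (carrier G \<rightarrow>\<^sub>E carrier H)"
    using assms by (intro finite_PiE) auto
qed

lemma finite_test_tuples:
  assumes "finite (carrier G)"
  shows "finite (test_tuples G H k)"
  using assms by (auto simp: test_tuples_def power_group_def intro!: finite_PiE)

lemma card_eval_kernel_pos:
  assumes G: "group G" and H: "group H"
    and fin: "finite (carrier G)" "finite (carrier H)"
    and x: "x \<in> carrier (power_group G k)"
  shows "card (eval_kernel G H k x) > 0"
proof -
  interpret G: group G by (rule G)
  interpret H: group H by (rule H)
  have xi: "x i \<in> carrier G" if "i < k" for i
    using x that by (auto simp: power_group_def)
  have "one (hom_group G H) \<in> eval_kernel G H k x"
    using xi by (auto simp: eval_kernel_def kernel_def hom_group_def hom_def power_group_def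
        eval_tuple_def fun_eq_iff restrict_def extensional_def)
  moreover have "finite (eval_kernel G H k x)"
    using finite_hom_group[OF fin] by (simp add: eval_kernel_def kernel_def)
  ultimately show ?thesis
    by (auto simp: card_gt_0_iff)
qed

lemma pmf_test_ker_sample:
  assumes "group G" "group H" "finite (carrier G)" "finite (carrier H)"
    and ne: "test_tuples G H k \<noteq> {}"
  shows "pmf (test_ker_sample G H k) x =
    (if x \<in> test_tuples G H k
     then real (card (eval_kernel G H k x)) /
          (\<Sum>y\<in>test_tuples G H k. real (card (eval_kernel G H k y)))
     else 0)"
proof -
  let ?T = "test_tuples G H k"
  let ?w = "\<lambda>x. real (card (eval_kernel G H k x))"
  let ?g = "\<lambda>x. if x \<in> ?T then ?w x / sum ?w ?T else 0"
  have fin: "finite ?T"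
    using assms by (intro finite_test_tuples)
  have pos: "sum ?w ?T > 0"
    using assms fin card_eval_kernel_pos[of G H]
    by (intro sum_pos) (auto simp: test_tuples_def)
  have "(\<integral>\<^sup>+ x. ennreal (?g x) \<partial>count_space UNIV) = (\<Sum>x\<in>?T. ennreal (?g x))"
    using fin by (intro nn_integral_count_space') (auto split: if_splits)
  also have "\<dots> = ennreal (\<Sum>x\<in>?T. ?g x)"
    by (intro sum_ennreal) (auto intro!: divide_nonneg_nonneg sum_nonneg)
  also have "(\<Sum>x\<in>?T. ?g x) = 1"
    using pos by (simp flip: sum_divide_distrib)
  finally have "(\<integral>\<^sup>+ x. ennreal (?g x) \<partial>count_space UNIV) = 1"
    by simp
  thus ?thesis
    unfolding test_ker_sample_def
    by (subst pmf_embed_pmf) (auto intro!: divide_nonneg_nonneg sum_nonneg)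
qed

end

(*
  Double counting turns the acceptance probability into a ratio of moments: f restricted to x lies
  in H_x iff some homomorphism interpolates it there, and then exactly |ker Gamma_x| of them do, so
    delta_k = (SUM phi. agr(f, phi)^k) / (SUM phi. agr(1, phi)^k),
  where for k >= 2 the tuple set G_k is all of G^k, since |Hom(G, H)| <= |H| < |H|^k.
  Write D_k for the denominator. If phi(1) has order p^j then agr(1, phi) = p^-j, and H has at most
  p^(t j) elements killed by p^j, so 1 <= D_k <= SUM j. p^(-j (k - t)).
  The upper bound follows from max agr^k <= delta_k D_k. For the lower bound, factor out
  max agr^(k - t - 1) from the numerator; the remaining sum of (t + 1)-st powers is
  delta_(t+1) D_(t+1) <= D_(t+1) <= p / (p - 1).
*)
theory Submission
  imports Defs "HOL-Algebra.Multiplicative_Group"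
begin

section \<open>Agreement, kernels and interpolation as cardinalities\<close>

lemma carrier_power_group: "carrier (power_group G k) = {..<k} \<rightarrow>\<^sub>E carrier G"
  by (simp add: power_group_def)

lemma carrier_hom_group: "carrier (hom_group G H) = hom G H \<inter> extensional (carrier G)"
  by (simp add: hom_group_def)

lemma agr_eq_card:
  assumes "finite (carrier G)" "carrier G \<noteq> {}"
  shows "agr G f \<phi> = card {x \<in> carrier G. f x = \<phi> x} / card (carrier G)"
proof -
  have "carrier G \<inter> {x. f x = \<phi> x} = {x \<in> carrier G. f x = \<phi> x}"
    by auto
  with measure_pmf_of_set[OF assms(2,1), of "{x. f x = \<phi> x}"] show ?thesis
    by (simp add: agr_def)
qed

lemma agr_nonneg: "0 \<le> agr G f \<phi>"
  by (simp add: agr_def)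

lemma restrict_eq_restrict_iff: "restrict f A = restrict g A \<longleftrightarrow> (\<forall>x\<in>A. f x = g x)"
  by (metis restrict_apply' restrict_ext)

text \<open>The identity stands on the left so that the kernel reads as the set of homomorphisms
  interpolating the constant function one, the form in which the counting lemmas take
  \<open>f\<close>.\<close>

lemma eval_kernel_eq:
  "eval_kernel G H k x = {\<phi> \<in> carrier (hom_group G H). \<forall>i<k. \<one>\<^bsub>H\<^esub> = \<phi> (x i)}"
  by (auto simp: eval_kernel_def kernel_def power_group_def eval_tuple_def restrict_eq_restrict_iff
      Ball_def)

lemma eval_tuple_in_image_iff:
  "eval_tuple k x f \<in> eval_image G H k x \<longleftrightarrow>
     (\<exists>\<phi>\<in>carrier (hom_group G H). \<forall>i<k. f (x i) = \<phi> (x i))"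
  by (simp add: eval_image_def eval_tuple_def image_iff restrict_eq_restrict_iff Ball_def)

section \<open>Double counting of tuples and interpolating homomorphisms\<close>

text \<open>Once one interpolating homomorphism exists, all of them form its coset of the kernel.
  Commutativity of \<open>H\<close> keeps pointwise products and inverses homomorphisms.\<close>

lemma card_interpolating_homs:
  assumes G: "group G" and H: "comm_group H"
    and x: "x \<in> carrier (power_group G k)"
    and mem: "eval_tuple k x f \<in> eval_image G H k x"
  shows "card {\<phi> \<in> carrier (hom_group G H). \<forall>i<k. f (x i) = \<phi> (x i)} = card (eval_kernel G H k x)"
proof -
  interpret G: group G by (rule G)
  interpret H: comm_group H by (rule H)
  obtain \<phi> where \<phi>: "\<phi> \<in> carrier (hom_group G H)" "\<And>i. i < k \<Longrightarrow> \<phi> (x i) = f (x i)"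
    using mem by (metis eval_tuple_in_image_iff)
  have xi: "x i \<in> carrier G" if "i < k" for i
    using x that by (auto simp: power_group_def)
  have \<phi>c [simp]: "\<phi> a \<in> carrier H" if "a \<in> carrier G" for a
    using \<phi> that by (auto simp: carrier_hom_group hom_def)
  have \<phi>m [simp]: "\<phi> (a \<otimes>\<^bsub>G\<^esub> b) = \<phi> a \<otimes>\<^bsub>H\<^esub> \<phi> b" if "a \<in> carrier G" "b \<in> carrier G" for a b
    using \<phi> that by (auto simp: carrier_hom_group hom_def)
  have homD: "\<psi> a \<in> carrier H" if "\<psi> \<in> hom G H" "a \<in> carrier G" for \<psi> a
    using that by (auto simp: hom_def)
  have fx: "f (x i) \<in> carrier H" if "i < k" for i
    using \<phi>(2)[OF that] \<phi>c[OF xi[OF that]] by simp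
  have inv_mult_cancel: "inv\<^bsub>H\<^esub> a \<otimes>\<^bsub>H\<^esub> (a \<otimes>\<^bsub>H\<^esub> b) = b"
    and mult_inv_cancel: "a \<otimes>\<^bsub>H\<^esub> (inv\<^bsub>H\<^esub> a \<otimes>\<^bsub>H\<^esub> b) = b"
    if "a \<in> carrier H" "b \<in> carrier H" for a b
    using that by (simp_all flip: H.m_assoc)
  have "bij_betw (\<lambda>\<psi>. \<lambda>a\<in>carrier G. \<phi> a \<otimes>\<^bsub>H\<^esub> \<psi> a) (eval_kernel G H k x)
      {\<phi> \<in> carrier (hom_group G H). \<forall>i<k. f (x i) = \<phi> (x i)}"
  \<comment> \<open>Translation by \<open>\<phi>\<close> is undone by translation by its pointwise
    inverse; restriction to the carrier keeps both maps within the extensional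
    representatives.\<close>
  proof (rule bij_betw_byWitness[where f' = "\<lambda>\<psi>. \<lambda>a\<in>carrier G. inv\<^bsub>H\<^esub> \<phi> a \<otimes>\<^bsub>H\<^esub> \<psi> a"])
    show "\<forall>\<psi>\<in>eval_kernel G H k x.
        (\<lambda>a\<in>carrier G. inv\<^bsub>H\<^esub> \<phi> a \<otimes>\<^bsub>H\<^esub> (\<lambda>a\<in>carrier G. \<phi> a \<otimes>\<^bsub>H\<^esub> \<psi> a) a) = \<psi>"
      by (auto simp: eval_kernel_eq carrier_hom_group inv_mult_cancel homD
          intro!: extensionalityI[where A = "carrier G"])
    show "\<forall>\<psi>\<in>{\<phi> \<in> carrier (hom_group G H). \<forall>i<k. f (x i) = \<phi> (x i)}.
        (\<lambda>a\<in>carrier G. \<phi> a \<otimes>\<^bsub>H\<^esub> (\<lambda>a\<in>carrier G. inv\<^bsub>H\<^esub> \<phi> a \<otimes>\<^bsub>H\<^esub> \<psi> a) a) = \<psi>"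
      by (auto simp: carrier_hom_group mult_inv_cancel homD
          intro!: extensionalityI[where A = "carrier G"])
    show "(\<lambda>\<psi>. \<lambda>a\<in>carrier G. \<phi> a \<otimes>\<^bsub>H\<^esub> \<psi> a) ` eval_kernel G H k x
        \<subseteq> {\<phi> \<in> carrier (hom_group G H). \<forall>i<k. f (x i) = \<phi> (x i)}"
      by (auto simp: eval_kernel_eq carrier_hom_group hom_def \<phi>(2) xi fx Pi_iff H.m_ac)
    show "(\<lambda>\<psi>. \<lambda>a\<in>carrier G. inv\<^bsub>H\<^esub> \<phi> a \<otimes>\<^bsub>H\<^esub> \<psi> a) `
        {\<phi> \<in> carrier (hom_group G H). \<forall>i<k. f (x i) = \<phi> (x i)} \<subseteq> eval_kernel G H k x"
    proof clarsimp
      fix \<psi> assume \<psi>: "\<psi> \<in> carrier (hom_group G H)" "\<forall>i<k. f (x i) = \<psi> (x i)"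
      have "\<psi> (x i) \<in> carrier H" if "i < k" for i
        using fx[OF that] \<psi>(2) that by simp
      with \<psi> show "(\<lambda>a\<in>carrier G. inv\<^bsub>H\<^esub> \<phi> a \<otimes>\<^bsub>H\<^esub> \<psi> a) \<in> eval_kernel G H k x"
        by (auto simp: eval_kernel_eq carrier_hom_group hom_def \<phi>(2) xi Pi_iff
            H.inv_mult H.m_ac)
    qed
  qed
  thus ?thesis
    by (rule bij_betw_same_card[symmetric])
qed

text \<open>With the value 0 at rejected tuples, the count is the sampling weight times the
  indicator of acceptance and can be summed over all tuples.\<close>

lemma card_interpolating_homs_if:
  assumes "group G" "comm_group H" "x \<in> carrier (power_group G k)"
  shows "card {\<phi> \<in> carrier (hom_group G H). \<forall>i<k. f (x i) = \<phi> (x i)} =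
    (if eval_tuple k x f \<in> eval_image G H k x then card (eval_kernel G H k x) else 0)"
proof (cases "eval_tuple k x f \<in> eval_image G H k x")
  case False
  hence *: "{\<phi> \<in> carrier (hom_group G H). \<forall>i<k. f (x i) = \<phi> (x i)} = {}"
    by (auto simp: eval_tuple_in_image_iff)
  show ?thesis
    unfolding * using False by simp
next
  case True
  show ?thesis
    unfolding card_interpolating_homs[OF assms True] using True by simp
qed

text \<open>Both sides count the pairs of a tuple and a homomorphism agreeing with \<open>f\<close>
  at every entry, once by tuple and once by homomorphism.\<close>

lemma sum_card_interpolating_homs:
  assumes G: "group G" and H: "group H" and fin: "finite (carrier G)" "finite (carrier H)"
  shows "(\<Sum>x\<in>carrier (power_group G k).
            real (card {\<phi> \<in> carrier (hom_group G H). \<forall>i<k. f (x i) = \<phi> (x i)})) =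
         real (card (carrier G)) ^ k * (\<Sum>\<phi>\<in>carrier (hom_group G H). agr G f \<phi> ^ k)"
proof -
  let ?X = "carrier (hom_group G H)" and ?T = "carrier (power_group G k)"
  interpret G: group G by (rule G)
  have ne: "carrier G \<noteq> {}" and pos: "card (carrier G) > 0"
    using G.one_closed fin by (auto simp: card_gt_0_iff)
  have finX: "finite ?X"
    using fin by (rule finite_hom_group)
  have finT: "finite ?T"
    using fin by (auto simp: carrier_power_group intro!: finite_PiE)
  \<comment> \<open>For a fixed homomorphism the entries range independently over its agreement set,
    which produces the k-th power.\<close>
  have fiber: "real (card {x \<in> ?T. \<forall>i<k. f (x i) = \<phi> (x i)}) =
      real (card (carrier G)) ^ k * agr G f \<phi> ^ k" for \<phi>
  proof -
    have "{x \<in> ?T. \<forall>i<k. f (x i) = \<phi> (x i)} = {..<k} \<rightarrow>\<^sub>E {a \<in> carrier G. f a = \<phi> a}"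
      by (auto simp: carrier_power_group PiE_def Pi_iff)
    hence "card {x \<in> ?T. \<forall>i<k. f (x i) = \<phi> (x i)} = card {a \<in> carrier G. f a = \<phi> a} ^ k"
      by (simp add: card_PiE)
    thus ?thesis
      using pos by (simp add: agr_eq_card[OF fin(1) ne] power_divide)
  qed
  have "(\<Sum>x\<in>?T. real (card {\<phi> \<in> ?X. \<forall>i<k. f (x i) = \<phi> (x i)})) =
      (\<Sum>x\<in>?T. \<Sum>\<phi>\<in>?X. if \<forall>i<k. f (x i) = \<phi> (x i) then 1 else 0)"
    using finX by (simp add: sum.If_cases Int_def)
  also have "\<dots> = (\<Sum>\<phi>\<in>?X. real (card {x \<in> ?T. \<forall>i<k. f (x i) = \<phi> (x i)}))"
    using finT by (subst sum.swap) (simp add: sum.If_cases Int_def)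
  finally show ?thesis
    by (simp add: fiber sum_distrib_left)
qed

text \<open>The double count for the constant function one; it evaluates the normalising constant of
  the sampler.\<close>

lemma sum_card_eval_kernel:
  assumes "group G" "group H" "finite (carrier G)" "finite (carrier H)"
  shows "(\<Sum>x\<in>carrier (power_group G k). real (card (eval_kernel G H k x))) =
         real (card (carrier G)) ^ k *
           (\<Sum>\<phi>\<in>carrier (hom_group G H). agr G (\<lambda>_. \<one>\<^bsub>H\<^esub>) \<phi> ^ k)"
  unfolding sum_card_interpolating_homs[OF assms, symmetric]
  by (intro sum.cong refl) (simp add: eval_kernel_eq)

text \<open>A tuple has either no interpolating homomorphism or as many as its kernel has elements.
  This is the bound 1 on an acceptance probability, cleared of its denominator; the theorem uses it
  with exponent t + 1.\<close>

lemma sum_agr_power_le: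
  assumes "group G" "comm_group H" "finite (carrier G)" "finite (carrier H)"
  shows "(\<Sum>\<phi>\<in>carrier (hom_group G H). agr G f \<phi> ^ k) \<le>
         (\<Sum>\<phi>\<in>carrier (hom_group G H). agr G (\<lambda>_. \<one>\<^bsub>H\<^esub>) \<phi> ^ k)"
proof -
  have H: "group H"
    using assms(2) by (simp add: comm_group_def)
  have "card (carrier G) > 0"
    using assms by (auto simp: card_gt_0_iff dest: group.is_monoid[THEN monoid.one_closed])
  moreover have "(\<Sum>x\<in>carrier (power_group G k).
      real (card {\<phi> \<in> carrier (hom_group G H). \<forall>i<k. f (x i) = \<phi> (x i)})) \<le>
      (\<Sum>x\<in>carrier (power_group G k). real (card (eval_kernel G H k x)))"
    by (intro sum_mono) (simp add: card_interpolating_homs_if assms)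
  ultimately show ?thesis
    by (simp add: sum_card_interpolating_homs sum_card_eval_kernel assms H)
qed

lemma test_ker_prob_eq:
  assumes G: "group G" and H: "comm_group H" and fin: "finite (carrier G)" "finite (carrier H)"
    and all: "test_tuples G H k = carrier (power_group G k)"
  shows "test_ker_prob G H k f =
    (\<Sum>\<phi>\<in>carrier (hom_group G H). agr G f \<phi> ^ k) /
    (\<Sum>\<phi>\<in>carrier (hom_group G H). agr G (\<lambda>_. \<one>\<^bsub>H\<^esub>) \<phi> ^ k)"
proof -
  let ?T = "carrier (power_group G k)" and ?S = "test_ker_sample G H k"
  let ?w = "\<lambda>x. real (card (eval_kernel G H k x))"
  let ?A = "{x. eval_tuple k x f \<in> eval_image G H k x}"
  interpret G: group G by (rule G)
  interpret H: comm_group H by (rule H)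
  have pos: "card (carrier G) > 0"
    using G.one_closed fin by (auto simp: card_gt_0_iff)
  have finT: "finite ?T"
    using fin by (auto simp: carrier_power_group intro!: finite_PiE)
  \<comment> \<open>Nonemptiness makes the total weight positive, so that the weights do sum to
    1.\<close>
  have ne: "test_tuples G H k \<noteq> {}"
    unfolding all using G.one_closed by (auto simp: carrier_power_group PiE_eq_empty_iff)
  have pmf: "pmf ?S x = (if x \<in> ?T then ?w x / sum ?w ?T else 0)" for x
    using pmf_test_ker_sample[OF G H.is_group fin ne] by (simp add: all)
  \<comment> \<open>The sampler has no mass outside \<open>?T\<close>, so the event can be cut down
    to a finite set.\<close>
  have "test_ker_prob G H k f = measure_pmf.prob ?S (?T \<inter> ?A)"
    unfolding test_ker_prob_def by (rule measure_prob_cong_0) (auto simp: pmf)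
  also have "\<dots> = (\<Sum>x\<in>?T \<inter> ?A. ?w x / sum ?w ?T)"
    using finT by (simp add: measure_measure_pmf_finite pmf)
  also have "\<dots> = (\<Sum>x\<in>?T. if x \<in> ?A then ?w x else 0) / sum ?w ?T"
    by (simp only: sum.inter_restrict[OF finT, symmetric] sum_divide_distrib)
  also have "(\<Sum>x\<in>?T. if x \<in> ?A then ?w x else 0) =
      (\<Sum>x\<in>?T. real (card {\<phi> \<in> carrier (hom_group G H). \<forall>i<k. f (x i) = \<phi> (x i)}))"
    by (intro sum.cong refl) (simp add: card_interpolating_homs_if G H)
  finally show ?thesis
    using pos G.one_closed by (auto simp: sum_card_interpolating_homs sum_card_eval_kernel G H.is_group fin)
qed

section \<open>Torsion in a finite abelian group of given p-rank\<close>

lemma pow_product_group: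
  fixes m :: nat
  assumes "i \<in> I"
  shows "(x [^]\<^bsub>product_group I G\<^esub> m) i = x i [^]\<^bsub>G i\<^esub> m"
  using assms by (induction m) auto

text \<open>If q divides m x and 0 <= x < q, then the quotient m x / q lies in [0, m) and determines
  x.\<close>

lemma card_multiples_le:
  fixes q m :: nat
  assumes "q > 0" "m > 0"
  shows "card {x \<in> {0..<int q}. int m * x mod int q = 0} \<le> m"
proof -
  have "card {x \<in> {0..<int q}. int m * x mod int q = 0} \<le> card {0..<int m}"
  proof (rule card_inj_on_le[where f = "\<lambda>x. int m * x div int q"])
    show "inj_on (\<lambda>x. int m * x div int q) {x \<in> {0..<int q}. int m * x mod int q = 0}"
    proof (rule inj_onI)
      fix x y assume "x \<in> {x \<in> {0..<int q}. int m * x mod int q = 0}"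
        "y \<in> {x \<in> {0..<int q}. int m * x mod int q = 0}" "int m * x div int q = int m * y div int q"
      hence "int m * x = int m * y"
        by (metis (mono_tags, lifting) mem_Collect_eq mult_div_mod_eq)
      thus "x = y"
        using assms by simp
    qed
    show "(\<lambda>x. int m * x div int q) ` {x \<in> {0..<int q}. int m * x mod int q = 0} \<subseteq> {0..<int m}"
    proof clarsimp
      fix x assume "0 \<le> x" "x < int q" "int q dvd int m * x"
      then obtain y where y: "int m * x = int q * y" by blast
      have "int q * y < int q * int m"
        using assms \<open>x < int q\<close> unfolding y[symmetric] by simp
      moreover have "0 \<le> int q * y"
        using \<open>0 \<le> x\<close> unfolding y[symmetric] by simp
      ultimately show "0 \<le> int m * x div int q \<and> int m * x div int q < int m"
        using assms by (simp add: y zero_le_mult_iff)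
    qed
  qed simp
  thus ?thesis
    by simp
qed

lemma card_multiples_coprime:
  fixes q m :: nat
  assumes "q > 0" "coprime m q"
  shows "card {x \<in> {0..<int q}. int m * x mod int q = 0} = 1"
proof -
  have "{x \<in> {0..<int q}. int m * x mod int q = 0} = {0}"
  proof (intro equalityI subsetI)
    fix x assume x: "x \<in> {x \<in> {0..<int q}. int m * x mod int q = 0}"
    hence "int q dvd int m * x" by auto
    moreover have "coprime (int q) (int m)"
      using assms by (simp add: coprime_commute)
    ultimately have "int q dvd x"
      by (simp add: coprime_dvd_mult_right_iff)
    thus "x \<in> {0}"
      using x zdvd_not_zless[of x "int q"] by force
  qed (use assms in auto)
  thus ?thesis
    by simp
qed

text \<open>In the cyclic decomposition the torsion condition splits into coordinates. A factor of
  p-power order has at most p^j solutions, any other factor only the identity, and t factors are of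
  the first kind.\<close>

lemma card_p_torsion_le:
  assumes p: "prime p" and H: "group H" and rank: "has_p_rank p H t"
  shows "card {h \<in> carrier H. h [^]\<^bsub>H\<^esub> (p ^ j) = \<one>\<^bsub>H\<^esub>} \<le> (p ^ j) ^ t"
proof -
  interpret H: group H by (rule H)
  obtain n :: nat and q :: "nat \<Rightarrow> nat" where q: "\<And>i. i < n \<Longrightarrow> primepow (q i)"
    and iso: "H \<cong> product_group {..<n} (\<lambda>i. integer_mod_group (q i))"
    and t: "t = card {i. i < n \<and> (\<exists>e>0. q i = p ^ e)}"
    using rank unfolding has_p_rank_def by blast
  let ?P = "product_group {..<n} (\<lambda>i. integer_mod_group (q i))"
  let ?C = "\<lambda>i. {x \<in> {0..<int (q i)}. int (p ^ j) * x mod int (q i) = 0}"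
  interpret P: group ?P by simp
  obtain g where g: "g \<in> Group.iso H ?P"
    using iso by (auto simp: is_iso_def)
  hence hom: "g \<in> hom H ?P" and inj: "inj_on g (carrier H)"
    by (auto simp: Group.iso_def bij_betw_def)
  \<comment> \<open>\<open>integer_mod_group 0\<close> is the infinite group of integers; positivity
    gives the carrier as the interval [0, q i).\<close>
  have q0: "q i > 0" if "i < n" for i
    using primepow_gt_Suc_0[OF q[OF that]] by simp
  have "card {h \<in> carrier H. h [^]\<^bsub>H\<^esub> (p ^ j) = \<one>\<^bsub>H\<^esub>} \<le> card (\<Pi>\<^sub>E i\<in>{..<n}. ?C i)"
  proof (rule card_inj_on_le[where f = g])
    show "inj_on g {h \<in> carrier H. h [^]\<^bsub>H\<^esub> (p ^ j) = \<one>\<^bsub>H\<^esub>}"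
      using inj by (rule inj_on_subset) auto
    show "g ` {h \<in> carrier H. h [^]\<^bsub>H\<^esub> (p ^ j) = \<one>\<^bsub>H\<^esub>} \<subseteq> (\<Pi>\<^sub>E i\<in>{..<n}. ?C i)"
    proof clarify
      fix h assume h: "h \<in> carrier H" "h [^]\<^bsub>H\<^esub> (p ^ j) = \<one>\<^bsub>H\<^esub>"
      have gh: "g h \<in> carrier ?P"
        using hom h(1) by (auto simp: hom_def)
      have "g h [^]\<^bsub>?P\<^esub> (p ^ j) = \<one>\<^bsub>?P\<^esub>"
        using hom_nat_pow[OF hom h(1) H P.is_group, of "p ^ j"] hom_one[OF hom H P.is_group] h(2)
        by metis
      hence "int (p ^ j) * g h i mod int (q i) = 0" if "i < n" for i
        using that pow_product_group[of i "{..<n}" "\<lambda>i. integer_mod_group (q i)" "g h" "p ^ j"]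
        by simp
      moreover have "g h i \<in> {0..<int (q i)}" if "i < n" for i
        using gh that q0[OF that] by (auto simp: carrier_integer_mod_group PiE_def Pi_def)
      ultimately show "g h \<in> (\<Pi>\<^sub>E i\<in>{..<n}. ?C i)"
        using gh by (auto simp: PiE_def)
    qed
    show "finite (\<Pi>\<^sub>E i\<in>{..<n}. ?C i)"
      by (intro finite_PiE finite_Collect_conjI) auto
  qed
  also have "\<dots> = (\<Prod>i<n. card (?C i))"
    by (simp add: card_PiE)
  also have "\<dots> \<le> (\<Prod>i<n. if \<exists>e>0. q i = p ^ e then p ^ j else 1)"
  proof (rule prod_mono, clarify)
    fix i assume "i < n"
    have "card (?C i) \<le> p ^ j"
      using p by (intro card_multiples_le q0 \<open>i < n\<close>) (simp add: prime_gt_0_nat)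
    moreover have "card (?C i) = 1" if "\<not> (\<exists>e>0. q i = p ^ e)"
    proof (rule card_multiples_coprime[OF q0[OF \<open>i < n\<close>]])
      \<comment> \<open>A prime power that is not a power of p belongs to another prime, hence is
        coprime to p^j.\<close>
      obtain l e where l: "prime l" "e > 0" "q i = l ^ e"
        using q[OF \<open>i < n\<close>] by (auto simp: primepow_def)
      with that have "p \<noteq> l"
        by blast
      hence "coprime p l"
        using primes_coprime[OF p l(1)] by simp
      thus "coprime (p ^ j) (q i)"
        by (simp add: l(3))
    qed
    ultimately show "0 \<le> card (?C i) \<and> card (?C i) \<le> (if \<exists>e>0. q i = p ^ e then p ^ j else 1)"
      by auto
  qed
  also have "\<dots> = (p ^ j) ^ t"
    by (simp add: prod.If_cases t Int_def lessThan_def)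
  finally show ?thesis .
qed

section \<open>Homomorphisms out of a cyclic group\<close>

text \<open>The bound \<open>1 < N\<close> puts the integer 1 into the carrier, where x is its
  x-fold sum.\<close>

lemma hom_integer_mod_group_eq_pow:
  assumes "group H" "1 < N" "\<phi> \<in> hom (integer_mod_group N) H" "0 \<le> x" "x < int N"
  shows "\<phi> x = \<phi> 1 [^]\<^bsub>H\<^esub> nat x"
proof -
  have "\<phi> (1 [^]\<^bsub>integer_mod_group N\<^esub> nat x) = \<phi> 1 [^]\<^bsub>H\<^esub> nat x"
    using assms by (intro hom_nat_pow) auto
  thus ?thesis
    using assms by simp
qed

text \<open>A homomorphism is determined by its value at the generator; this lets homomorphisms be
  counted through elements of \<open>H\<close>.\<close>

lemma inj_on_eval_generator:
  assumes "group H" "1 < N"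
  shows "inj_on (\<lambda>\<phi>. \<phi> 1) (carrier (hom_group (integer_mod_group N) H))"
proof (rule inj_onI)
  fix \<phi> \<psi>
  assume \<phi>: "\<phi> \<in> carrier (hom_group (integer_mod_group N) H)"
    and \<psi>: "\<psi> \<in> carrier (hom_group (integer_mod_group N) H)" and "\<phi> 1 = \<psi> 1"
  have "\<phi> x = \<psi> x" if "x \<in> carrier (integer_mod_group N)" for x
  proof -
    have "0 \<le> x" "x < int N"
      using that assms(2) by (auto simp: carrier_integer_mod_group)
    with \<phi> \<psi> \<open>\<phi> 1 = \<psi> 1\<close> show ?thesis
      using hom_integer_mod_group_eq_pow[OF assms, of \<phi> x]
        hom_integer_mod_group_eq_pow[OF assms, of \<psi> x] by (simp add: carrier_hom_group)
  qed
  with \<phi> \<psi> show "\<phi> = \<psi>"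
    by (auto simp: carrier_hom_group intro: extensionalityI)
qed

lemma hom_eval_generator:
  assumes "1 < N" "\<phi> \<in> carrier (hom_group (integer_mod_group N) H)"
  shows "\<phi> 1 \<in> carrier H"
  using assms by (auto simp: carrier_hom_group hom_def carrier_integer_mod_group)

lemma card_hom_integer_mod_group_le:
  assumes "group H" "finite (carrier H)" "1 < N"
  shows "card (carrier (hom_group (integer_mod_group N) H)) \<le> card (carrier H)"
  using assms hom_eval_generator[OF assms(3)]
  by (intro card_inj_on_le[OF inj_on_eval_generator[OF assms(1,3)]]) auto

lemma test_tuples_integer_mod_group:
  assumes "group H" "finite (carrier H)" "1 < card (carrier H)" "1 < N" "2 \<le> k"
  shows "test_tuples (integer_mod_group N) H k = carrier (power_group (integer_mod_group N) k)"
proof -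
  let ?G = "integer_mod_group N"
  have "eval_image ?G H k x \<noteq> carrier (power_group H k)" for x
  proof
    assume eq: "eval_image ?G H k x = carrier (power_group H k)"
    have "finite (carrier (hom_group ?G H))"
      using assms by (intro finite_hom_group) (auto simp: carrier_integer_mod_group)
    hence "card (eval_image ?G H k x) \<le> card (carrier H)"
      unfolding eval_image_def using card_hom_integer_mod_group_le[OF assms(1,2,4)]
      by (meson card_image_le order_trans)
    moreover have "card (carrier (power_group H k)) = card (carrier H) ^ k"
      by (simp add: carrier_power_group card_PiE)
    \<comment> \<open>Strictness rests on both |H| > 1 and k >= 2; for trivial \<open>H\<close> no
      tuple would qualify.\<close>
    moreover have "card (carrier H) ^ 1 < card (carrier H) ^ k"
      using assms by (intro power_strict_increasing) auto
    ultimately show False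
      using eq by simp
  qed
  thus ?thesis
    by (auto simp: test_tuples_def)
qed

section \<open>Moments of the agreement with the constant function one\<close>

text \<open>With p^j the order of \<open>\<phi> 1\<close>, the value one can occur only at multiples
  of p^j, a fraction p^-j of [0, p^r).\<close>

lemma agr_one_le:
  assumes p: "prime p" and r: "r \<ge> 1" and H: "group H"
    and \<phi>: "\<phi> \<in> carrier (hom_group (integer_mod_group (p ^ r)) H)"
  obtains j where "j \<le> r" "\<phi> 1 [^]\<^bsub>H\<^esub> (p ^ j) = \<one>\<^bsub>H\<^esub>"
    "agr (integer_mod_group (p ^ r)) (\<lambda>_. \<one>\<^bsub>H\<^esub>) \<phi> \<le> (1 / real p) ^ j"
proof -
  let ?G = "integer_mod_group (p ^ r)"
  interpret H: group H by (rule H)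
  have N: "1 < p ^ r"
    using p r by (intro one_less_power) (auto simp: prime_gt_Suc_0_nat)
  have p0: "p > 0"
    using p by (simp add: prime_gt_0_nat)
  have hom: "\<phi> \<in> hom ?G H"
    using \<phi> by (simp add: carrier_hom_group)
  have c: "\<phi> 1 \<in> carrier H"
    using hom_eval_generator[OF N \<phi>] .
  \<comment> \<open>The p^r-fold sum of 1 vanishes in the cyclic group, so the order of
    \<open>\<phi> 1\<close> divides p^r and is itself some p^j.\<close>
  have "\<phi> (1 [^]\<^bsub>?G\<^esub> (p ^ r)) = \<phi> 1 [^]\<^bsub>H\<^esub> (p ^ r)"
    using p r H hom by (intro hom_nat_pow) auto
  hence "\<phi> 1 [^]\<^bsub>H\<^esub> (p ^ r) = \<one>\<^bsub>H\<^esub>"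
    using hom_one[OF hom _ H] by simp
  hence "H.ord (\<phi> 1) dvd p ^ r"
    using H.pow_eq_id[OF c] by blast
  then obtain j where j: "j \<le> r" "H.ord (\<phi> 1) = p ^ j"
    using divides_primepow_nat[OF p] by blast
  have "card {x \<in> carrier ?G. \<one>\<^bsub>H\<^esub> = \<phi> x} \<le> card {0..<int (p ^ (r - j))}"
  \<comment> \<open>Division by p^j maps the multiples of p^j below p^r injectively into the numbers
    below p^(r - j).\<close>
  proof (rule card_inj_on_le[where f = "\<lambda>x. x div int (p ^ j)"])
    have dvd: "int (p ^ j) dvd x \<and> 0 \<le> x \<and> x < int (p ^ r)"
      if "x \<in> {x \<in> carrier ?G. \<one>\<^bsub>H\<^esub> = \<phi> x}" for x
    proof -
      have x: "0 \<le> x" "x < int (p ^ r)" "\<phi> x = \<one>\<^bsub>H\<^esub>"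
        using that p0 by (auto simp: carrier_integer_mod_group)
      hence "\<phi> 1 [^]\<^bsub>H\<^esub> nat x = \<one>\<^bsub>H\<^esub>"
        using hom_integer_mod_group_eq_pow[OF H N hom] by simp
      hence "p ^ j dvd nat x"
        using H.pow_eq_id[OF c] j by simp
      thus ?thesis
        using x by (metis int_dvd_int_iff int_nat_eq)
    qed
    show "inj_on (\<lambda>x. x div int (p ^ j)) {x \<in> carrier ?G. \<one>\<^bsub>H\<^esub> = \<phi> x}"
      by (rule inj_onI) (metis dvd dvd_div_mult_self)
    show "(\<lambda>x. x div int (p ^ j)) ` {x \<in> carrier ?G. \<one>\<^bsub>H\<^esub> = \<phi> x} \<subseteq> {0..<int (p ^ (r - j))}"
    proof
      fix y assume "y \<in> (\<lambda>x. x div int (p ^ j)) ` {x \<in> carrier ?G. \<one>\<^bsub>H\<^esub> = \<phi> x}"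
      then obtain x where y: "y = x div int (p ^ j)" and x: "x \<in> {x \<in> carrier ?G. \<one>\<^bsub>H\<^esub> = \<phi> x}"
        by auto
      have "x = y * int (p ^ j)"
        using dvd[OF x] by (auto simp: y)
      moreover have "int (p ^ r) = int (p ^ (r - j)) * int (p ^ j)"
        using j(1) by (metis le_add_diff_inverse2 of_nat_mult power_add)
      ultimately have "0 \<le> y * int (p ^ j)" "y * int (p ^ j) < int (p ^ (r - j)) * int (p ^ j)"
        using dvd[OF x] by auto
      moreover have "int (p ^ j) > 0"
        using p0 by simp
      ultimately show "y \<in> {0..<int (p ^ (r - j))}"
        by (auto simp: zero_le_mult_iff mult_less_cancel_right simp del: of_nat_power)
    qed
  qed simp
  hence le: "real (card {x \<in> carrier ?G. \<one>\<^bsub>H\<^esub> = \<phi> x}) \<le> real (p ^ (r - j))"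
    by (simp flip: of_nat_power)
  have "agr ?G (\<lambda>_. \<one>\<^bsub>H\<^esub>) \<phi> = real (card {x \<in> carrier ?G. \<one>\<^bsub>H\<^esub> = \<phi> x}) / real (p ^ r)"
    using N p0 by (subst agr_eq_card) (auto simp: carrier_integer_mod_group)
  also have "\<dots> \<le> real (p ^ (r - j)) / real (p ^ r)"
    using le by (rule divide_right_mono) simp
  also have "\<dots> = (1 / real p) ^ j"
    using p0 j(1) power_diff[of "real p" j r] by (simp add: power_divide)
  finally show ?thesis
    using that[OF j(1)] H.pow_ord_eq_1[OF c] j(2) by simp
qed

text \<open>At level j the torsion bound p^(t j) meets the agreement power p^(-j (t + s)), leaving a
  geometric series in p^-s, where s is the excess of the exponent over the p-rank.\<close>

lemma sum_agr_one_power_le: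
  assumes p: "prime p" and r: "r \<ge> 1" and H: "group H" and fin: "finite (carrier H)"
    and rank: "has_p_rank p H t" and s: "s \<ge> 1"
  shows "(\<Sum>\<phi>\<in>carrier (hom_group (integer_mod_group (p ^ r)) H).
            agr (integer_mod_group (p ^ r)) (\<lambda>_. \<one>\<^bsub>H\<^esub>) \<phi> ^ (t + s)) \<le> 1 / (1 - (1 / real p) ^ s)"
proof -
  let ?G = "integer_mod_group (p ^ r)" and ?e = "\<lambda>_::int. \<one>\<^bsub>H\<^esub>"
  let ?X = "carrier (hom_group ?G H)"
  let ?Y = "\<lambda>j. {\<phi> \<in> ?X. \<phi> 1 [^]\<^bsub>H\<^esub> (p ^ j) = \<one>\<^bsub>H\<^esub>}"
  have N: "1 < p ^ r"
    using p r by (intro one_less_power) (auto simp: prime_gt_Suc_0_nat)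
  have p1: "real p > 1"
    using prime_gt_1_nat[OF p] by simp
  have finX: "finite ?X"
    using fin p1 by (intro finite_hom_group) (auto simp: carrier_integer_mod_group)
  have cardY: "card (?Y j) \<le> (p ^ j) ^ t" for j
  proof -
    have "card (?Y j) \<le> card {h \<in> carrier H. h [^]\<^bsub>H\<^esub> (p ^ j) = \<one>\<^bsub>H\<^esub>}"
      using fin hom_eval_generator[OF N]
      by (intro card_inj_on_le[OF inj_on_subset[OF inj_on_eval_generator[OF H N]]]) auto
    also have "\<dots> \<le> (p ^ j) ^ t"
      by (rule card_p_torsion_le[OF p H rank])
    finally show ?thesis .
  qed
  \<comment> \<open>The sets \<open>?Y j\<close> are nested, not disjoint. One level bounds each
    homomorphism; the further levels containing it only add nonnegative terms.\<close>
  have "(\<Sum>\<phi>\<in>?X. agr ?G ?e \<phi> ^ (t + s)) \<le>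
      (\<Sum>\<phi>\<in>?X. \<Sum>j\<le>r. if \<phi> \<in> ?Y j then ((1 / real p) ^ j) ^ (t + s) else 0)"
  proof (rule sum_mono)
    fix \<phi> assume \<phi>: "\<phi> \<in> ?X"
    obtain j where j: "j \<le> r" "\<phi> 1 [^]\<^bsub>H\<^esub> (p ^ j) = \<one>\<^bsub>H\<^esub>" "agr ?G ?e \<phi> \<le> (1 / real p) ^ j"
      using agr_one_le[OF p r H \<phi>] .
    have "agr ?G ?e \<phi> ^ (t + s) \<le> ((1 / real p) ^ j) ^ (t + s)"
      using j(3) by (intro power_mono agr_nonneg)
    also have "\<dots> = (if \<phi> \<in> ?Y j then ((1 / real p) ^ j) ^ (t + s) else 0)"
      using \<phi> j(2) by simp
    also have "\<dots> \<le> (\<Sum>j\<le>r. if \<phi> \<in> ?Y j then ((1 / real p) ^ j) ^ (t + s) else 0)"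
      using j(1) by (intro member_le_sum) auto
    finally show "agr ?G ?e \<phi> ^ (t + s) \<le>
        (\<Sum>j\<le>r. if \<phi> \<in> ?Y j then ((1 / real p) ^ j) ^ (t + s) else 0)" .
  qed
  also have "\<dots> = (\<Sum>j\<le>r. real (card (?Y j)) * ((1 / real p) ^ j) ^ (t + s))"
    using finX by (subst sum.swap) (simp add: sum.If_cases Int_def)
  also have "\<dots> \<le> (\<Sum>j\<le>r. ((1 / real p) ^ s) ^ j)"
  proof (rule sum_mono)
    fix j
    have "real (card (?Y j)) * ((1 / real p) ^ j) ^ (t + s) \<le>
        real ((p ^ j) ^ t) * ((1 / real p) ^ j) ^ (t + s)"
      using cardY by (intro mult_right_mono) (simp_all only: of_nat_le_iff, simp)
    also have "\<dots> = (real p ^ j * (1 / real p) ^ j) ^ t * ((1 / real p) ^ j) ^ s"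
      by (simp add: power_add power_mult_distrib)
    also have "real p ^ j * (1 / real p) ^ j = 1"
      using p1 by (simp add: power_divide)
    finally show "real (card (?Y j)) * ((1 / real p) ^ j) ^ (t + s) \<le> ((1 / real p) ^ s) ^ j"
      by (simp add: mult.commute flip: power_mult)
  qed
  \<comment> \<open>Passing to the infinite series makes the bound independent of r.\<close>
  also have "\<dots> \<le> (\<Sum>j. ((1 / real p) ^ s) ^ j)"
    using p1 s by (intro sum_le_suminf summable_geometric) (auto simp: power_less_one_iff)
  also have "\<dots> = 1 / (1 - (1 / real p) ^ s)"
    using p1 s by (intro suminf_geometric) (auto simp: power_less_one_iff)
  finally show ?thesis .
qed

text \<open>The trivial homomorphism alone contributes 1.\<close>

lemma one_le_sum_agr_one_power:
  assumes "group G" "group H" "finite (carrier G)" "finite (carrier H)"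
  shows "1 \<le> (\<Sum>\<phi>\<in>carrier (hom_group G H). agr G (\<lambda>_. \<one>\<^bsub>H\<^esub>) \<phi> ^ k)"
proof -
  interpret G: group G by fact
  interpret H: group H by fact
  let ?\<phi> = "\<lambda>x\<in>carrier G. \<one>\<^bsub>H\<^esub>"
  have "carrier G \<noteq> {}"
    using G.one_closed by auto
  moreover have "{x \<in> carrier G. \<one>\<^bsub>H\<^esub> = ?\<phi> x} = carrier G"
    by auto
  ultimately have "agr G (\<lambda>_. \<one>\<^bsub>H\<^esub>) ?\<phi> = 1"
    using assms by (simp add: agr_eq_card)
  moreover have "?\<phi> \<in> carrier (hom_group G H)"
    by (auto simp: carrier_hom_group hom_def)
  ultimately show ?thesis
    using member_le_sum[of ?\<phi> "carrier (hom_group G H)" "\<lambda>\<phi>. agr G (\<lambda>_. \<one>\<^bsub>H\<^esub>) \<phi> ^ k"]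
      finite_hom_group[OF assms(3,4)] by (simp add: agr_nonneg)
qed

section \<open>From powers to real roots\<close>

lemma root_le_of_le_power:
  fixes a M :: real
  assumes "0 \<le> a" "a \<le> M ^ n" "0 \<le> M" "0 < n"
  shows "a powr (1 / real n) \<le> M"
proof -
  have "a powr (1 / real n) \<le> (M ^ n) powr (1 / real n)"
    using assms by (intro powr_mono2) auto
  \<comment> \<open>Rewriting the power as \<open>powr\<close> needs a positive base, so
    \<open>M = 0\<close> is treated apart; there both sides are 0.\<close>
  also have "\<dots> = M"
    using assms by (cases "M = 0") (auto simp: powr_powr simp flip: powr_realpow)
  finally show ?thesis .
qed

lemma le_root_of_power_le:
  fixes a M :: real
  assumes "M ^ n \<le> a" "0 \<le> M" "0 < n"
  shows "M \<le> a powr (1 / real n)"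
proof -
  have "M = (M ^ n) powr (1 / real n)"
    using assms by (cases "M = 0") (auto simp: powr_powr simp flip: powr_realpow)
  also have "\<dots> \<le> a powr (1 / real n)"
    using assms by (intro powr_mono2) auto
  finally show ?thesis .
qed

text \<open>Positive p-rank yields a cyclic factor, whose order is a prime power and so exceeds 1;
  this order divides the product |H|.\<close>

lemma card_gt_1_of_p_rank_pos:
  assumes rank: "has_p_rank p H t" and t: "t \<ge> 1" and fin: "finite (carrier H)"
  shows "1 < card (carrier H)"
proof -
  obtain n :: nat and q :: "nat \<Rightarrow> nat" where q: "\<And>i. i < n \<Longrightarrow> primepow (q i)"
    and iso: "H \<cong> product_group {..<n} (\<lambda>i. integer_mod_group (q i))"
    and t': "t = card {i. i < n \<and> (\<exists>e>0. q i = p ^ e)}"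
    using rank unfolding has_p_rank_def by blast
  obtain g where "bij_betw g (carrier H) (\<Pi>\<^sub>E i\<in>{..<n}. carrier (integer_mod_group (q i)))"
    using iso by (auto simp: is_iso_def Group.iso_def)
  hence "card (carrier H) = (\<Prod>i<n. card (carrier (integer_mod_group (q i))))"
    using bij_betw_same_card by (fastforce simp: card_PiE)
  also have "\<dots> = (\<Prod>i<n. q i)"
    using primepow_gt_Suc_0[OF q] by (intro prod.cong) (auto simp: carrier_integer_mod_group)
  finally have card: "card (carrier H) = (\<Prod>i<n. q i)" .
  have "{i. i < n \<and> (\<exists>e>0. q i = p ^ e)} \<noteq> {}"
    using t t' by (metis card.empty not_one_le_zero)
  then obtain i where i: "i < n"
    by blast
  have "(\<Prod>i<n. q i) > 0"
    using primepow_gt_Suc_0[OF q] by (intro prod_pos) (auto intro: Suc_lessD)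
  hence "q i \<le> (\<Prod>i<n. q i)"
    using i by (intro dvd_imp_le dvd_prodI) auto
  thus ?thesis
    using primepow_gt_Suc_0[OF q[OF i]] by (simp add: card)
qed

section \<open>The two bounds on the maximal agreement\<close>

theorem theorem3p4:
  fixes p r t k :: nat
    and H :: "('a, 'm) monoid_scheme"
    and f :: "int \<Rightarrow> 'a"
    and \<delta> :: real
  defines "G \<equiv> integer_mod_group (p ^ r)"
  assumes "prime p" and "r \<ge> 1"
    and "comm_group H" and "finite (carrier H)"
    and "has_p_rank p H t" and "t \<ge> 1"
    and "k \<ge> t + 2"
    and "f \<in> carrier G \<rightarrow> carrier H"
    and "\<delta> = test_ker_prob G H k f"
  shows "((real p - 1)\<^sup>2 / (real p)\<^sup>2 * \<delta>) powr (1 / (real k - real t - 1))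
           \<le> (MAX \<phi>\<in>carrier (hom_group G H). agr G f \<phi>)
       \<and> (MAX \<phi>\<in>carrier (hom_group G H). agr G f \<phi>)
           \<le> ((real p)\<^sup>2 / ((real p)\<^sup>2 - 1) * \<delta>) powr (1 / real k)"
proof -
  define X where "X = carrier (hom_group G H)"
  define M where "M = (MAX \<phi>\<in>X. agr G f \<phi>)"
  define S where "S m = (\<Sum>\<phi>\<in>X. agr G f \<phi> ^ m)" for m
  define D where "D m = (\<Sum>\<phi>\<in>X. agr G (\<lambda>_. \<one>\<^bsub>H\<^esub>) \<phi> ^ m)" for m
  interpret H: comm_group H by fact
  have N: "1 < p ^ r"
    using assms(2,3) by (intro one_less_power) (auto simp: prime_gt_Suc_0_nat)
  have p1: "real p > 1"
    using prime_gt_1_nat[OF assms(2)] by simp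
  have G: "group G" and finG: "finite (carrier G)"
    using p1 by (auto simp: G_def carrier_integer_mod_group)
  note GH = G assms(4) finG assms(5)
  have finX: "finite X"
    unfolding X_def using finG assms(5) by (rule finite_hom_group)
  \<comment> \<open>The trivial homomorphism shows that \<open>X\<close> is nonempty, so the maximum
    is attained.\<close>
  have "(\<lambda>x\<in>carrier G. \<one>\<^bsub>H\<^esub>) \<in> X"
    using group.is_monoid[OF G] by (auto simp: X_def carrier_hom_group hom_def monoid.m_closed)
  hence neX: "X \<noteq> {}"
    by auto
  have leM: "agr G f \<phi> \<le> M" if "\<phi> \<in> X" for \<phi>
    unfolding M_def using finX that by simp
  have "M \<in> agr G f ` X"
    unfolding M_def using finX neX by (intro Max_in) auto
  then obtain \<phi>0 where \<phi>0: "\<phi>0 \<in> X" "M = agr G f \<phi>0"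
    by auto
  have M0: "M \<ge> 0"
    using \<phi>0 by (simp add: agr_nonneg)
  have D1: "D m \<ge> 1" for m
    unfolding D_def X_def using one_le_sum_agr_one_power[OF G H.is_group finG assms(5)] .
  have D_le: "D (t + s) \<le> 1 / (1 - (1 / real p) ^ s)" if "s \<ge> 1" for s
    unfolding D_def X_def G_def
    using sum_agr_one_power_le[OF assms(2,3) H.is_group assms(5,6) that] .
  have all: "test_tuples G H k = carrier (power_group G k)"
    unfolding G_def using assms(7,8) N
    by (intro test_tuples_integer_mod_group H.is_group assms(5)
        card_gt_1_of_p_rank_pos[OF assms(6,7,5)]) auto
  have \<delta>: "\<delta> = S k / D k"
    unfolding S_def D_def X_def assms(10) using test_ker_prob_eq[OF GH all] .
  have S0: "S m \<ge> 0" for m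
    unfolding S_def by (intro sum_nonneg zero_le_power agr_nonneg)
  have \<delta>0: "\<delta> \<ge> 0"
    using S0[of k] D1[of k] by (simp add: \<delta>)

  have "\<delta> \<le> S k"
    using D1[of k] S0[of k] mult_left_mono[of 1 "D k" "S k"] by (simp add: \<delta> divide_le_eq)
  also have "S k \<le> (\<Sum>\<phi>\<in>X. M ^ (k - t - 1) * agr G f \<phi> ^ (t + 1))"
    unfolding S_def
  proof (rule sum_mono)
    fix \<phi> assume "\<phi> \<in> X"
    \<comment> \<open>As k >= t + 2, the natural subtraction does not truncate.\<close>
    have "k = (k - t - 1) + (t + 1)"
      using assms(8) by simp
    hence "agr G f \<phi> ^ k = agr G f \<phi> ^ (k - t - 1) * agr G f \<phi> ^ (t + 1)"
      by (metis power_add)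
    also have "\<dots> \<le> M ^ (k - t - 1) * agr G f \<phi> ^ (t + 1)"
      using leM[OF \<open>\<phi> \<in> X\<close>] by (intro mult_right_mono power_mono zero_le_power agr_nonneg)
    finally show "agr G f \<phi> ^ k \<le> M ^ (k - t - 1) * agr G f \<phi> ^ (t + 1)" .
  qed
  also have "\<dots> = M ^ (k - t - 1) * S (t + 1)"
    by (simp add: S_def sum_distrib_left)
  also have "\<dots> \<le> M ^ (k - t - 1) * D (t + 1)"
    unfolding S_def D_def X_def using M0
    by (intro mult_left_mono sum_agr_power_le[OF GH] zero_le_power)
  \<comment> \<open>The moment bound with s = 1: 1 / (1 - 1/p) = p / (p - 1).\<close>
  also have "\<dots> \<le> M ^ (k - t - 1) * (real p / (real p - 1))"
    using D_le[of 1] p1 M0 by (intro mult_left_mono) (auto simp: field_simps)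
  \<comment> \<open>The factor p / (p - 1) is at least 1, so it may be squared to reach the claimed
    constant.\<close>
  also have "\<dots> \<le> M ^ (k - t - 1) * (real p / (real p - 1))\<^sup>2"
    using M0 p1 by (intro mult_left_mono self_le_power) auto
  finally have "(real p - 1)\<^sup>2 / (real p)\<^sup>2 * \<delta> \<le>
      (real p - 1)\<^sup>2 / (real p)\<^sup>2 * (M ^ (k - t - 1) * (real p / (real p - 1))\<^sup>2)"
    by (intro mult_left_mono) auto
  also have "\<dots> = M ^ (k - t - 1)"
    using p1 by (simp add: field_simps)
  finally have lower: "((real p - 1)\<^sup>2 / (real p)\<^sup>2 * \<delta>) powr (1 / real (k - t - 1)) \<le> M"
    using M0 \<delta>0 assms(8) by (intro root_le_of_le_power) auto

  \<comment> \<open>Upper bound: a maximising homomorphism contributes one term of the k-th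
    moment.\<close>
  have "M ^ k \<le> S k"
    unfolding S_def \<phi>0(2) using finX \<phi>0(1)
    by (intro member_le_sum[where f = "\<lambda>\<phi>. agr G f \<phi> ^ k"] zero_le_power agr_nonneg)
  also have "S k = \<delta> * D k"
    using D1[of k] by (simp add: \<delta>)
  also have "\<dots> \<le> \<delta> * ((real p)\<^sup>2 / ((real p)\<^sup>2 - 1))"
  proof (intro mult_left_mono \<delta>0)
    \<comment> \<open>Here the excess is s = k - t >= 2, and s = 2 is the worst case; it gives the
      constant p^2 / (p^2 - 1).\<close>
    have "(1 / real p) ^ (k - t) \<le> (1 / real p) ^ 2"
      using p1 assms(8) by (intro power_decreasing) auto
    moreover have "(1 / real p) ^ 2 < 1"
      using p1 by (simp add: power_less_one_iff)
    ultimately have "1 / (1 - (1 / real p) ^ (k - t)) \<le> 1 / (1 - (1 / real p) ^ 2)"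
      by (intro divide_left_mono mult_pos_pos) auto
    also have "\<dots> = (real p)\<^sup>2 / ((real p)\<^sup>2 - 1)"
      using p1 by (simp add: field_simps)
    finally show "D k \<le> (real p)\<^sup>2 / ((real p)\<^sup>2 - 1)"
      using D_le[of "k - t"] assms(8) by force
  qed
  finally have "M ^ k \<le> (real p)\<^sup>2 / ((real p)\<^sup>2 - 1) * \<delta>"
    by (simp only: mult.commute)
  hence upper: "M \<le> ((real p)\<^sup>2 / ((real p)\<^sup>2 - 1) * \<delta>) powr (1 / real k)"
    using M0 assms(8) by (intro le_root_of_power_le) auto
  have "real k - real t - 1 = real (k - t - 1)"
    using assms(8) by simp
  with lower upper show ?thesis
    unfolding M_def X_def by simp
qed

end
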